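(* Let $B$ be a real Banach space with dual $B^*$ and let $C$ be a nonempty subset of $B$. Then: (a) $V:B^*\times B\to\mathbb{R}$ is continuous. (b) $V(\phi,x)$ is convex in $\phi$ when $x$ is fixed, and convex in $x$ when $\phi$ is fixed. (c) For any $x\in B$ and any $\phi\in B^*$, $(\|\phi\|-\|x\|)^2\le V(\phi,x)\le(\|\phi\|+\|x\|)^2$. (d) For any $x\in B$ and any $\phi\in B^*$, $V(\phi,x)=0$ if and only if $\phi\in J(x)$. (e) For any $y,z\in C$ and any $jy\in J(y)$, $z\in\pi_C(jy)$ if and only if $jy\in J(z)$. (f) $\pi_C$ is monotone on $B^*$: for all $\phi_1,\phi_2\in B^*$, $\langle\phi_1-\phi_2,u_1-u_2\rangle\ge 0$ for any $u_1\in\pi_C(\phi_1)$ and $u_2\in\pi_C(\phi_2)$.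
   Context: $B$ is a real Banach space with dual $B^*$ and pairing $\langle\cdot,\cdot\rangle$ between $B^*$ and $B$. The normalized duality map is $J(x)=\{\psi\in B^*:\langle\psi,x\rangle=\|\psi\|\|x\|=\|x\|^2=\|\psi\|^2\}$ for $x\in B$. The functional $V:B^*\times B\to\mathbb{R}$ is $V(\phi,x)=\|\phi\|^2-2\langle\phi,x\rangle+\|x\|^2$. For a nonempty $C\subseteq B$, the generalized projection $\pi_C:B^*\to 2^C$ is $\pi_C(\phi)=\{u\in C: V(\phi,u)=\inf_{y\in C}V(\phi,y)\}$ (possibly empty). *)

theory Defs
  imports "HOL-Analysis.Analysis"
begin

text \<open>The topological dual of a real normed space is the type of bounded linear functionals
  with the operator norm; the pairing of \<open>\<phi>\<close> and \<open>x\<close> is \<^term>\<open>blinfun_apply \<phi> x\<close>.\<close>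

type_synonym 'a dual = "'a \<Rightarrow>\<^sub>L real"

definition duality_map :: "'a::real_normed_vector \<Rightarrow> 'a dual set" where
  "duality_map x =
     {\<psi>. blinfun_apply \<psi> x = norm \<psi> * norm x \<and>
         norm \<psi> * norm x = (norm x)\<^sup>2 \<and>
         (norm x)\<^sup>2 = (norm \<psi>)\<^sup>2}"

definition V :: "'a::real_normed_vector dual \<Rightarrow> 'a \<Rightarrow> real" where
  "V \<phi> x = (norm \<phi>)\<^sup>2 - 2 * blinfun_apply \<phi> x + (norm x)\<^sup>2"

text \<open>For nonempty \<open>C\<close> the infimum is a genuine one, since \<^const>\<open>V\<close> is bounded below by 0.\<close>

definition gen_proj :: "'a::real_normed_vector set \<Rightarrow> 'a dual \<Rightarrow> 'a set" where
  "gen_proj C \<phi> = {u \<in> C. V \<phi> u = (INF y\<in>C. V \<phi> y)}"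

end

theory Submission
  imports Defs
begin

text \<open>Everything rests on the inequality |<phi, x>| \<le> |phi| |x|, which traps
  \<open>V\<close> between the squares of the difference and of the sum of the two norms
  (\<open>V_lower\<close>, \<open>V_upper\<close>). So \<open>V\<close> is nonnegative, and it
  vanishes exactly when both norms agree and the pairing attains its bound, which is membership in
  the duality map (\<open>V_eq_0_iff\<close>). If a functional lies in the duality map of a point of
  \<open>C\<close>, its minimum over \<open>C\<close> is therefore 0, and its minimizers in
  \<open>C\<close> are the zeros of \<open>V\<close>. Monotonicity follows by letting each
  projection compete in the other's minimization. Convexity holds since \<open>V\<close> is a
  squared norm plus an affine function in each variable.\<close>

lemma convex_on_norm_power2:
  "convex_on UNIV (\<lambda>x :: 'a::real_normed_vector. (norm x)\<^sup>2)"
proof (rule convex_onI)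
  fix t :: real and x y :: 'a
  assume t: "0 < t" "t < 1"
  have "norm ((1 - t) *\<^sub>R x + t *\<^sub>R y) \<le> (1 - t) * norm x + t * norm y"
    using t by (intro norm_triangle_le) simp
  then have "(norm ((1 - t) *\<^sub>R x + t *\<^sub>R y))\<^sup>2 \<le> ((1 - t) * norm x + t * norm y)\<^sup>2"
    by (intro power_mono) auto
  \<comment> \<open>The gap between chord and parabola is an explicit nonnegative square.\<close>
  also have "\<dots> = (1 - t) * (norm x)\<^sup>2 + t * (norm y)\<^sup>2 - (1 - t) * t * (norm x - norm y)\<^sup>2"
    by (simp add: power2_eq_square algebra_simps)
  also have "\<dots> \<le> (1 - t) * (norm x)\<^sup>2 + t * (norm y)\<^sup>2"
    using t by simp
  finally show "(norm ((1 - t) *\<^sub>R x + t *\<^sub>R y))\<^sup>2 \<le> (1 - t) * (norm x)\<^sup>2 + t * (norm y)\<^sup>2" .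
qed simp

lemma convex_on_linear:
  fixes f :: "'a::real_vector \<Rightarrow> real"
  assumes "linear f"
  shows "convex_on UNIV f"
  by (rule convex_onI) (simp_all add: linear_add[OF assms] linear_scale[OF assms])

lemma continuous_on_V: "continuous_on UNIV (\<lambda>(\<phi>, x). V \<phi> x)"
  unfolding V_def split_beta by (intro continuous_intros)

lemma convex_on_V_functional: "convex_on UNIV (\<lambda>\<phi>. V \<phi> x)"
proof -
  have "linear (\<lambda>\<phi>. - 2 * blinfun_apply \<phi> x :: real)"
    by (rule linearI) (simp_all add: blinfun.bilinear_simps algebra_simps)
  then have "convex_on UNIV (\<lambda>\<phi>. (norm \<phi>)\<^sup>2 + (- 2 * blinfun_apply \<phi> x + (norm x)\<^sup>2))"
    by (intro convex_on_add convex_on_norm_power2 convex_on_linear convex_on_const[THEN iffD2]) auto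
  then show ?thesis
    by (simp add: V_def algebra_simps)
qed

lemma convex_on_V_vector: "convex_on UNIV (\<lambda>x. V \<phi> x)"
proof -
  have "linear (\<lambda>x. - 2 * blinfun_apply \<phi> x)"
    by (rule linearI) (simp_all add: blinfun.bilinear_simps algebra_simps)
  then have "convex_on UNIV (\<lambda>x. (norm \<phi>)\<^sup>2 + (- 2 * blinfun_apply \<phi> x + (norm x)\<^sup>2))"
    by (intro convex_on_add convex_on_norm_power2 convex_on_linear convex_on_const[THEN iffD2]) auto
  then show ?thesis
    by (simp add: V_def algebra_simps)
qed

text \<open>The two gaps are twice |phi| |x| - <phi, x> and twice |phi| |x| + <phi, x>, both
  nonnegative by the operator norm bound.\<close>

lemma V_bounds:
  shows V_lower: "(norm \<phi> - norm x)\<^sup>2 \<le> V \<phi> x"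
    and V_upper: "V \<phi> x \<le> (norm \<phi> + norm x)\<^sup>2"
  using norm_blinfun[of \<phi> x] by (auto simp: V_def power2_eq_square algebra_simps abs_le_iff)

lemma V_nonneg: "0 \<le> V \<phi> x"
  using V_lower[of \<phi> x] zero_le_power2[of "norm \<phi> - norm x"] by linarith

lemma V_eq_0_iff: "V \<phi> x = 0 \<longleftrightarrow> \<phi> \<in> duality_map x"
proof
  assume V: "V \<phi> x = 0"
  \<comment> \<open>A square bounded above by 0 vanishes; with equal norms, \<open>V = 0\<close>
    then forces the pairing to equal the squared norm.\<close>
  with V_lower[of \<phi> x] have "norm \<phi> = norm x"
    by simp
  with V show "\<phi> \<in> duality_map x"
    by (simp add: V_def duality_map_def power2_eq_square)
next
  assume "\<phi> \<in> duality_map x"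
  then show "V \<phi> x = 0"
    by (auto simp: V_def duality_map_def)
qed

lemma gen_proj_le:
  assumes "u \<in> gen_proj C \<phi>" "y \<in> C"
  shows "V \<phi> u \<le> V \<phi> y"
proof -
  \<comment> \<open>An infimum of reals is a lower bound only for sets bounded below; nonnegativity
    of \<open>V\<close> provides this.\<close>
  have "bdd_below (V \<phi> ` C)"
    by (rule bdd_belowI2[of _ 0]) (rule V_nonneg)
  with assms show ?thesis
    by (auto simp: gen_proj_def intro: cINF_lower)
qed

lemma gen_proj_duality_map_iff:
  assumes "y \<in> C" "z \<in> C" "\<psi> \<in> duality_map y"
  shows "z \<in> gen_proj C \<psi> \<longleftrightarrow> \<psi> \<in> duality_map z"
proof -
  have 0: "V \<psi> y = 0"
    using assms by (simp add: V_eq_0_iff)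
  \<comment> \<open>The lower bound 0 is attained at \<open>y\<close>, so it is the minimum.\<close>
  then have "(INF x\<in>C. V \<psi> x) = 0"
    using assms V_nonneg by (intro cInf_eq_minimum) (auto intro: image_eqI[where x = y])
  with assms show ?thesis
    by (simp add: gen_proj_def V_eq_0_iff)
qed

text \<open>Adding the two minimality inequalities cancels every norm term of \<^const>\<open>V\<close>.\<close>

lemma gen_proj_monotone:
  assumes "u1 \<in> gen_proj C \<phi>1" "u2 \<in> gen_proj C \<phi>2"
  shows "0 \<le> blinfun_apply (\<phi>1 - \<phi>2) (u1 - u2)"
proof -
  have "u1 \<in> C" "u2 \<in> C"
    using assms by (auto simp: gen_proj_def)
  then have "V \<phi>1 u1 \<le> V \<phi>1 u2" "V \<phi>2 u2 \<le> V \<phi>2 u1"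
    using assms gen_proj_le by blast+
  then show ?thesis
    by (simp add: V_def blinfun.bilinear_simps)
qed

theorem proposition2p3:
  fixes C :: "'a::banach set"
  assumes "C \<noteq> {}"
  shows "continuous_on UNIV (\<lambda>(\<phi> :: 'a dual, x :: 'a). V \<phi> x)
    \<and> ((\<forall>x :: 'a. convex_on UNIV (\<lambda>\<phi>. V \<phi> x)) \<and> (\<forall>\<phi> :: 'a dual. convex_on UNIV (\<lambda>x. V \<phi> x)))
    \<and> (\<forall>(x :: 'a) (\<phi> :: 'a dual).
          (norm \<phi> - norm x)\<^sup>2 \<le> V \<phi> x \<and> V \<phi> x \<le> (norm \<phi> + norm x)\<^sup>2)
    \<and> (\<forall>(x :: 'a) (\<phi> :: 'a dual). V \<phi> x = 0 \<longleftrightarrow> \<phi> \<in> duality_map x)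
    \<and> (\<forall>y\<in>C. \<forall>z\<in>C. \<forall>jy\<in>duality_map y. z \<in> gen_proj C jy \<longleftrightarrow> jy \<in> duality_map z)
    \<and> (\<forall>(\<phi>1 :: 'a dual) (\<phi>2 :: 'a dual). \<forall>u1\<in>gen_proj C \<phi>1. \<forall>u2\<in>gen_proj C \<phi>2.
          0 \<le> blinfun_apply (\<phi>1 - \<phi>2) (u1 - u2))"
  by (intro conjI allI ballI continuous_on_V convex_on_V_functional convex_on_V_vector
      V_lower V_upper V_eq_0_iff gen_proj_duality_map_iff gen_proj_monotone)

end
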